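(* Let $n=2m$ and let $c\in\{1,2\}^n$ be the balanced true label vector ($c_i=1$ for $1\le i\le m$, $c_i=2$ for $m<i\le n$). Let $\gamma\in(0,1)\setminus\{\tfrac12\}$ with $\gamma m$ an integer. Let the symmetric adjacency matrix $A\in\{0,1\}^{n\times n}$ be generated by the undirected block model with edge-probability matrix $$P=\frac2m\begin{pmatrix}a&b\\ b&a\end{pmatrix}-\frac1{m^2}\begin{pmatrix}a^2&b^2\\ b^2&a^2\end{pmatrix},$$ where $a=a_n$ and $b=b_n$ may depend on $n$, and assume $a\neq b$. Let the conditional pseudo-likelihood (CPL) label estimates $\hat c_i(e)$ be computed from $A$ with equal class priors $\hat\pi_1=\hat\pi_2=\frac12$, parameter estimates $(\hat a,\hat b)$ and initial labeling $e$, and let $M_n(e)$ be the resulting mismatch ratio. Put $\tau_n^2=\frac{(a-b)^2}{a+b}$ and $a_\gamma=\gamma a+(1-\gamma)b$. In addition, assume that $$2(1+\varepsilon)a_\gamma\le\varepsilon(1-2\gamma)(a-b)$$ for some $\varepsilon\in(0,1)$. Then there exist sequences $\{u_n\},\{v_n\}\subset\mathbb R_+$ such that $$\log u_n+\log\log u_n\ \ge\ \log\Big(\frac4e h(\gamma)\Big)+\frac14\big[(1-\varepsilon)(1-2\gamma)\big]^2\tau_n^2,$$ $$\log v_n+\log\log v_n\ \ge\ \log\Big(\frac4e h(\gamma)\Big)+\frac{\varepsilon^2}{1+\varepsilon/3}\,a_\gamma,$$ and $$\mathbb P\Big[\sup_{(\hat a,\hat b)\in\mathcal P_{a,b}}\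 \sup_{e\in\mathcal E^\gamma_n}M_n(e)\ \ge\ 4h(\gamma)\Big(\frac1{\log u_n}+\frac2{\log v_n}\Big)\Big]\ \le\ 3\exp\big(-n[h(\gamma)-\kappa_\gamma(n)]\big),$$ where $\kappa_\gamma(n):=\frac1n\Big[\log\Big(\frac{n}{4\pi\gamma(1-\gamma)}\Big)+\frac1{3n}\Big]=o(1)$. In particular, if $\tau_n^2\to\infty$ and $a_\gamma\to\infty$, then $u_n,v_n\to\infty$ and the CPL estimate is uniformly consistent, i.e. $\sup_{(\hat a,\hat b)\in\mathcal P_{a,b}}\sup_{e\in\mathcal E_n^\gamma}M_n(e)\to0$ in probability.
   Context: Undirected block model: given the (deterministic) label vector $c\in\{1,2\}^n$, the entries $A_{ij}$, $1\le i\le j\le n$ (including the diagonal), are independent with $A_{ij}\sim\mathrm{Bernoulli}(P_{c_ic_j})$, and $A_{ji}=A_{ij}$. Here $a/m$ and $b/m$ are probabilities, i.e. $a,b\in[0,m]$, and $P_{k\ell}=2\tilde P_{k\ell}-\tilde P_{k\ell}^2$ with $\tilde P=\frac1m\begin{pmatrix}a&b\\ b&a\end{pmatrix}$. Initial labelings: $\mathcal E^\gamma_n=\{e\in\{1,2\}^n:\ \sum_{i=1}^m 1\{e_i=1\}=\gamma m=\sum_{i=m+1}^n1\{e_i=2\}\}$. Parameter estimates: $\mathcal P_{a,b}=\{(\hat a,\hat b):\ (\hat a-\hat b)(a-b)>0\}$, the collection of estimates having the same ordering as the true parameters $(a,b)$. CPL estimate: for $e\in\mathcal E_n^\gamma$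 and $(\hat a,\hat b)\in\mathcal P_{a,b}$ put - $b_{i\ell}(e)=\sum_{j=1}^nA_{ij}1\{e_j=\ell\}$ for $i\in\{1,\dots,n\}$, $\ell\in\{1,2\}$; - $R(e)$ the $2\times2$ matrix with entries $R_{k\ell}(e)=\frac1n\sum_{i=1}^n1\{e_i=k,\ c_i=\ell\}$; - $\hat P=\frac2m\begin{pmatrix}\hat a&\hat b\\ \hat b&\hat a\end{pmatrix}-\frac1{m^2}\begin{pmatrix}\hat a^2&\hat b^2\\ \hat b^2&\hat a^2\end{pmatrix}$; - $(\hat\theta_{k\ell}(e))$ the $2\times2$ matrix obtained from $[nR(e)\hat P]^T$ by dividing each row by its sum. Then $\hat c_i(e)=\arg\max_{k\in\{1,2\}}\big\{\log\hat\pi_k+\sum_{\ell=1}^2b_{i\ell}(e)\log\hat\theta_{k\ell}(e)\big\}$ with $\hat\pi_1=\hat\pi_2=\frac12$. The estimate depends on $(\hat a,\hat b)$, although this is suppressed in the notation. Mismatch ratio: $M_n(e)=\min_{\phi}\frac1n\sum_{i=1}^n1\{\hat c_i(e)\ne\phi(c_i)\}$, the minimum being over the two permutations $\phi$ of $\{1,2\}$. $h(p)=-p\log p-(1-p)\log(1-p)$ is the binary entropy function (natural logarithm), and $e$ in $4/e$ is Euler's number.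
   Formalization: The estimates (â,b̂) in P_{a,b} are restricted to [0,m]², the range of a and b; for unrestricted reals log θ̂ can be undefined, and â+b̂=2m makes P̂ constant, so all labels tie and the claim fails. *)

theory Defs
  imports "HOL-Probability.Probability" "HOL-Probability.Product_PMF"
    "HOL-Combinatorics.Permutations" "HOL-Library.Landau_Symbols"
begin

(* Nodes are 1, ..., n and labels are 1, 2, all of type nat; 2 x 2 matrices are functions of two
   indices that are only evaluated at 1, 2.  Throughout, n = 2m with m = n div 2. *)

definition sizes :: "real \<Rightarrow> nat set" where
  "sizes \<gamma> = {n. 0 < n \<and> even n \<and> \<gamma> * real (n div 2) \<in> \<int>}"

(* Limits "as n tends to infinity" run through the admissible sizes only. *)
definition size_filter :: "real \<Rightarrow> nat filter" where
  "size_filter \<gamma> = inf sequentially (principal (sizes \<gamma>))"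

definition true_label :: "nat \<Rightarrow> nat \<Rightarrow> nat" where
  "true_label n i = (if i \<le> n div 2 then 1 else 2)"

definition two_block :: "real \<Rightarrow> real \<Rightarrow> nat \<Rightarrow> nat \<Rightarrow> real" where
  "two_block x y k l = (if k = l then x else y)"

(* Used both with the true parameters (a, b) and with their estimates. *)
definition edge_prob :: "nat \<Rightarrow> real \<Rightarrow> real \<Rightarrow> nat \<Rightarrow> nat \<Rightarrow> real" where
  "edge_prob n a b k l =
     (let m = real (n div 2) in
      2 / m * two_block a b k l - 1 / m\<^sup>2 * two_block (a\<^sup>2) (b\<^sup>2) k l)"

type_synonym adjacency = "nat \<Rightarrow> nat \<Rightarrow> nat"

(* Law of the adjacency matrix: independent Bernoulli entries on and above the diagonal, extended
   symmetrically.  Entries outside {1..n} x {1..n} are 0. *)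
definition block_model :: "nat \<Rightarrow> (nat \<Rightarrow> nat) \<Rightarrow> (nat \<Rightarrow> nat \<Rightarrow> real) \<Rightarrow> adjacency pmf" where
  "block_model n c P =
     map_pmf (\<lambda>X i j. of_bool (X (min i j, max i j)))
       (Pi_pmf {(i, j). 1 \<le> i \<and> i \<le> j \<and> j \<le> n} False (\<lambda>(i, j). bernoulli_pmf (P (c i) (c j))))"

definition initial_labelings :: "real \<Rightarrow> nat \<Rightarrow> (nat \<Rightarrow> nat) set" where
  "initial_labelings \<gamma> n =
     {e \<in> {1..n} \<rightarrow>\<^sub>E {1, 2}.
        (\<Sum>i = 1..n div 2. of_bool (e i = 1)) = \<gamma> * real (n div 2) \<and>
        (\<Sum>i = n div 2 + 1..n. of_bool (e i = 2)) = \<gamma> * real (n div 2)}"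

(* Like a and b, the estimates are taken from [0, m].  On this range x \<mapsto> 2x/m - x^2/m^2 is increasing
   with values in [0, 1]; outside it, estimates such as ah + bh = 2m with ah \<noteq> bh would give equal
   within- and between-block probabilities. *)
definition param_estimates :: "nat \<Rightarrow> real \<Rightarrow> real \<Rightarrow> (real \<times> real) set" where
  "param_estimates n a b =
     {(ah, bh). ah \<in> {0..real (n div 2)} \<and> bh \<in> {0..real (n div 2)} \<and> (ah - bh) * (a - b) > 0}"

definition block_sum :: "nat \<Rightarrow> adjacency \<Rightarrow> (nat \<Rightarrow> nat) \<Rightarrow> nat \<Rightarrow> nat \<Rightarrow> nat" where
  "block_sum n A e i l = (\<Sum>j = 1..n. A i j * of_bool (e j = l))"

definition confusion :: "nat \<Rightarrow> (nat \<Rightarrow> nat) \<Rightarrow> (nat \<Rightarrow> nat) \<Rightarrow> nat \<Rightarrow> nat \<Rightarrow> real" where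
  "confusion n c e k l = 1 / real n * (\<Sum>i = 1..n. of_bool (e i = k \<and> c i = l))"

(* The matrix [n R(e) P]^T. *)
definition rate_matrix :: "nat \<Rightarrow> (nat \<Rightarrow> nat) \<Rightarrow> (nat \<Rightarrow> nat) \<Rightarrow> (nat \<Rightarrow> nat \<Rightarrow> real) \<Rightarrow> nat \<Rightarrow> nat \<Rightarrow> real"
  where "rate_matrix n c e P k l = (\<Sum>r\<in>{1, 2}. real n * confusion n c e l r * P r k)"

definition theta_hat :: "nat \<Rightarrow> (nat \<Rightarrow> nat) \<Rightarrow> (nat \<Rightarrow> nat) \<Rightarrow> real \<Rightarrow> real \<Rightarrow> nat \<Rightarrow> nat \<Rightarrow> real" where
  "theta_hat n c e ah bh k l =
     rate_matrix n c e (edge_prob n ah bh) k l /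
     (\<Sum>l'\<in>{1, 2}. rate_matrix n c e (edge_prob n ah bh) k l')"

definition class_prior :: "nat \<Rightarrow> real" where
  "class_prior k = 1 / 2"

definition cpl_score ::
  "nat \<Rightarrow> (nat \<Rightarrow> nat) \<Rightarrow> adjacency \<Rightarrow> real \<Rightarrow> real \<Rightarrow> (nat \<Rightarrow> nat) \<Rightarrow> nat \<Rightarrow> nat \<Rightarrow> real" where
  "cpl_score n c A ah bh e i k =
     ln (class_prior k) + (\<Sum>l\<in>{1, 2}. real (block_sum n A e i l) * ln (theta_hat n c e ah bh k l))"

(* The maximiser need not be unique; this is the set of all labelings obtained by some way of
   breaking ties. *)
definition cpl_labelings ::
  "nat \<Rightarrow> (nat \<Rightarrow> nat) \<Rightarrow> adjacency \<Rightarrow> real \<Rightarrow> real \<Rightarrow> (nat \<Rightarrow> nat) \<Rightarrow> (nat \<Rightarrow> nat) set" where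
  "cpl_labelings n c A ah bh e =
     {ch. \<forall>i\<in>{1..n}. is_arg_max (cpl_score n c A ah bh e i) (\<lambda>k. k \<in> {1, 2}) (ch i)}"

definition mismatch :: "nat \<Rightarrow> (nat \<Rightarrow> nat) \<Rightarrow> (nat \<Rightarrow> nat) \<Rightarrow> real" where
  "mismatch n c ch =
     (MIN \<phi>\<in>{\<phi>. \<phi> permutes {1, 2}}. 1 / real n * (\<Sum>i = 1..n. of_bool (ch i \<noteq> \<phi> (c i))))"

(* chat A ah bh e is the labeling computed from the data A, the estimates ah, bh and the initial
   labeling e. *)
definition worst_mismatch ::
  "real \<Rightarrow> nat \<Rightarrow> real \<Rightarrow> real \<Rightarrow> (adjacency \<Rightarrow> real \<Rightarrow> real \<Rightarrow> (nat \<Rightarrow> nat) \<Rightarrow> nat \<Rightarrow> nat) \<Rightarrow> adjacency \<Rightarrow> real"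
  where
  "worst_mismatch \<gamma> n a b chat A =
     (SUP (ah, bh)\<in>param_estimates n a b. SUP e\<in>initial_labelings \<gamma> n.
        mismatch n (true_label n) (chat A ah bh e))"

definition binary_entropy :: "real \<Rightarrow> real" where
  "binary_entropy p = - p * ln p - (1 - p) * ln (1 - p)"

definition tau_sq :: "real \<Rightarrow> real \<Rightarrow> real" where
  "tau_sq a b = (a - b)\<^sup>2 / (a + b)"

definition mix :: "real \<Rightarrow> real \<Rightarrow> real \<Rightarrow> real" where
  "mix \<gamma> a b = \<gamma> * a + (1 - \<gamma>) * b"

definition kappa :: "real \<Rightarrow> nat \<Rightarrow> real" where
  "kappa \<gamma> n = 1 / real n * (ln (real n / (4 * pi * \<gamma> * (1 - \<gamma>))) + 1 / (3 * real n))"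

end

theory Submission
  imports Defs "HOL-Real_Asymp.Real_Asymp"
begin

text \<open>For every admissible pair of estimates the CPL rule reduces to the same majority vote: node
  \<open>i\<close> can be misclassified only if at least half of its edges lead to nodes with
  \<open>e j = c i\<close>.  For a fixed \<open>e\<close> and a fixed set \<open>S\<close> of nodes, a Chernoff bound applied to the sum of
  all votes over \<open>S\<close> shows that \<open>S\<close> is misclassified with probability at most \<open>exp (- q) ^ card S\<close>,
  where \<open>q\<close> is the exponent in the condition on \<open>u\<close>; no independence between the rows is needed.
  Hence at least \<open>s\<close> nodes are misclassified with probability at most
  \<open>(n choose s) * exp (- q) ^ s \<le> (exp 1 * n * exp (- q) / s) ^ s\<close>, which is at most
  \<open>exp (- 4 * n * h)\<close> when \<open>s \<ge> 4 * n * h / ln u\<close> and the condition on \<open>u\<close> holds with equality.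
  A union bound over the at most \<open>exp (n * h)\<close> initial labelings concludes.\<close>

section \<open>Exponential moments of the block model\<close>

text \<open>The independent coordinates of the model are the entries on and above the diagonal.
  Reflecting the strict lower triangle onto the strict upper one regroups a sum over ordered pairs
  by these coordinates, with the diagonal counted once.\<close>

lemma sum_square_fold:
  fixes g :: "nat \<Rightarrow> nat \<Rightarrow> 'a::comm_monoid_add"
  shows "(\<Sum>i=1..n. \<Sum>j=1..n. g i j) =
    (\<Sum>(k, l)\<in>{(i, j). 1 \<le> i \<and> i \<le> j \<and> j \<le> n}. g k l + (if k < l then g l k else 0))"
proof -
  let ?U = "{(i, j). 1 \<le> i \<and> i \<le> j \<and> j \<le> n}"
  let ?V = "{(i, j). 1 \<le> i \<and> i < j \<and> j \<le> n}"
  have U: "finite ?U" by (rule finite_subset[of _ "{1..n} \<times> {1..n}"]) auto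
  have V: "finite ?V" by (rule finite_subset[of _ "{1..n} \<times> {1..n}"]) auto
  have sq: "{1..n} \<times> {1..n} = ?U \<union> prod.swap ` ?V"
    by (force simp: image_iff)
  have "(\<Sum>i=1..n. \<Sum>j=1..n. g i j) = (\<Sum>(i, j)\<in>{1..n} \<times> {1..n}. g i j)"
    by (simp add: sum.cartesian_product)
  also have "\<dots> = (\<Sum>(i, j)\<in>?U. g i j) + (\<Sum>(i, j)\<in>prod.swap ` ?V. g i j)"
    unfolding sq using U V by (intro sum.union_disjoint) auto
  also have "(\<Sum>(i, j)\<in>prod.swap ` ?V. g i j) = (\<Sum>(k, l)\<in>?V. g l k)"
    by (subst sum.reindex) (auto simp: case_prod_beta)
  also have "\<dots> = (\<Sum>(k, l)\<in>?U. if k < l then g l k else 0)"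
    using U by (intro sum.mono_neutral_cong_left) (auto split: if_splits)
  finally show ?thesis
    by (simp only: sum.distrib split_def)
qed

text \<open>An unordered pair enters the double sum with the two weights \<open>x i j\<close> and \<open>x j i\<close>; by AM-GM
  \<open>exp (s + t) \<le> (exp (2 * s) + exp (2 * t)) / 2\<close>, so the bound is the one for independent rows with
  halved edge probabilities.\<close>

lemma block_model_mgf_le:
  fixes x :: "nat \<Rightarrow> nat \<Rightarrow> real"
  assumes P: "\<And>i j. i \<in> {1..n} \<Longrightarrow> j \<in> {1..n} \<Longrightarrow> 0 \<le> P (c i) (c j) \<and> P (c i) (c j) \<le> 1"
    and sym: "\<And>i j. P (c i) (c j) = P (c j) (c i)"
  shows "(\<integral>A. exp (\<Sum>i=1..n. \<Sum>j=1..n. x i j * real (A i j)) \<partial>block_model n c P)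
    \<le> exp (\<Sum>i=1..n. \<Sum>j=1..n. P (c i) (c j) / 2 * (exp (2 * x i j) - 1))"
proof -
  define U where "U = {(i, j). 1 \<le> i \<and> i \<le> j \<and> j \<le> n}"
  define y where "y = (\<lambda>(k, l). x k l + (if k < l then x l k else 0))"
  have U: "finite U" unfolding U_def by (rule finite_subset[of _ "{1..n} \<times> {1..n}"]) auto
  have U_le: "min k l = k" "max k l = l" "min l k = k" "max l k = l" if "(k, l) \<in> U" for k l
    using that by (auto simp: U_def)
  define D where "D = (\<lambda>(i, j). bernoulli_pmf (P (c i) (c j)))"
  define G where "G = (\<lambda>(k, l). P (c k) (c l) / 2 * (exp (2 * x k l) - 1) +
      (if k < l then P (c l) (c k) / 2 * (exp (2 * x l k) - 1) else 0))"
  let ?Pi = "Pi_pmf U False D"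
  have "(\<integral>A. exp (\<Sum>i=1..n. \<Sum>j=1..n. x i j * real (A i j)) \<partial>block_model n c P)
     = (\<integral>X. exp (\<Sum>i=1..n. \<Sum>j=1..n. x i j * of_bool (X (min i j, max i j))) \<partial>?Pi)"
    by (simp add: block_model_def U_def D_def)
  also have "\<dots> = (\<integral>X. (\<Prod>u\<in>U. exp (y u * of_bool (X u))) \<partial>?Pi)"
    unfolding sum_square_fold U_def[symmetric]
    by (intro arg_cong2[of _ _ _ _ lebesgue_integral] refl ext)
       (auto simp: U_def[symmetric] y_def exp_sum[OF U] distrib_right U_le
          intro!: prod.cong)
  also have "\<dots> = (\<Prod>u\<in>U. \<integral>X. exp (y u * of_bool X) \<partial>D u)"
    unfolding D_def using U
    by (intro expectation_prod_Pi_pmf) (auto intro: integrable_measure_pmf_finite)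
  also have "\<dots> \<le> (\<Prod>u\<in>U. exp (G u))"
  proof (intro prod_mono conjI)
    fix u assume "u \<in> U"
    then obtain k l where u: "u = (k, l)" and kl: "1 \<le> k" "k \<le> l" "l \<le> n" by (auto simp: U_def)
    \<comment> \<open>On the diagonal \<open>z = 0\<close>; the AM-GM bound then reads
      \<open>exp x \<le> (exp (2 * x) + 1) / 2\<close> and gives exactly the single term of
      \<open>G\<close>.\<close>
    define z where "z = (if k < l then x l k else 0)"
    let ?p = "P (c k) (c l)"
    have p: "0 \<le> ?p" "?p \<le> 1" using P[of k l] kl by auto
    show "0 \<le> (\<integral>X. exp (y u * of_bool X) \<partial>D u)"
      by (intro Bochner_Integration.integral_nonneg) simp
    have sq: "exp (x k l + z) \<le> (exp (2 * x k l) + exp (2 * z)) / 2"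
    proof -
      have "2 * exp (x k l + z) = 2 * exp (x k l) * exp z" by (simp add: exp_add)
      also have "\<dots> \<le> (exp (x k l))\<^sup>2 + (exp z)\<^sup>2" by (rule sum_squares_bound)
      finally show ?thesis by (simp add: exp_double)
    qed
    have "(\<integral>X. exp (y u * of_bool X) \<partial>D u) = 1 + ?p * (exp (x k l + z) - 1)"
      using p by (simp add: u D_def y_def z_def algebra_simps)
    also have "\<dots> \<le> 1 + ?p * ((exp (2 * x k l) + exp (2 * z)) / 2 - 1)"
      using p sq by (intro add_left_mono mult_left_mono) auto
    also have "\<dots> \<le> exp (?p * ((exp (2 * x k l) + exp (2 * z)) / 2 - 1))"
      by (rule exp_ge_add_one_self)
    also have "?p * ((exp (2 * x k l) + exp (2 * z)) / 2 - 1) = G u"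
      using sym[of k l] by (auto simp: u z_def G_def field_simps)
    finally show "(\<integral>X. exp (y u * of_bool X) \<partial>D u) \<le> exp (G u)" .
  qed
  also have "\<dots> = exp (\<Sum>i=1..n. \<Sum>j=1..n. P (c i) (c j) / 2 * (exp (2 * x i j) - 1))"
    unfolding sum_square_fold U_def[symmetric] by (simp add: exp_sum[OF U] G_def)
  finally show ?thesis .
qed

text \<open>Markov's inequality with its conditions checked on the support only; finiteness of the
  support supplies integrability.\<close>

lemma prob_le_expectation:
  fixes f :: "'a \<Rightarrow> real"
  assumes "finite (set_pmf p)" "\<And>x. x \<in> set_pmf p \<Longrightarrow> 0 \<le> f x" "\<And>x. x \<in> set_pmf p \<Longrightarrow> x \<in> E \<Longrightarrow> 1 \<le> f x"
  shows "measure_pmf.prob p E \<le> (\<integral>x. f x \<partial>p)"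
proof -
  have "measure_pmf.prob p E = (\<integral>x. indicator E x \<partial>p)" by simp
  also have "\<dots> \<le> (\<integral>x. f x \<partial>p)"
    using assms by (intro integral_mono_AE integrable_measure_pmf_finite)
      (auto simp: AE_measure_pmf_iff indicator_def)
  finally show ?thesis .
qed

lemma finite_set_block_model: "finite (set_pmf (block_model n c P))"
proof -
  have U: "finite {(i::nat, j). 1 \<le> i \<and> i \<le> j \<and> j \<le> n}"
    by (rule finite_subset[of _ "{1..n} \<times> {1..n}"]) auto
  show ?thesis unfolding block_model_def
    using U by (auto simp: set_Pi_pmf intro!: finite_imageI finite_PiE_dflt)
qed

section \<open>Union bound over sets of nodes\<close>

text \<open>The binomial coefficient is at most \<open>n ^ s / fact s\<close>, and
  \<open>s ^ s / fact s\<close> is a single term of the power series of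
  \<open>exp s\<close>.\<close>

lemma choose_le_exp_power:
  assumes "0 < s"
  shows "real (n choose s) \<le> (exp 1 * real n / real s) ^ s"
proof -
  have "real s ^ s / fact s \<le> exp (real s)"
  proof -
    have "(\<Sum>k\<in>{s}. real s ^ k /\<^sub>R fact k) \<le> (\<Sum>k. real s ^ k /\<^sub>R fact k)"
      using exp_converges[of "real s"] by (intro sum_le_suminf) (auto simp: sums_iff)
    then show ?thesis by (simp add: exp_def divide_inverse mult.commute)
  qed
  moreover have "real (n choose s) * fact s \<le> real n ^ s"
    using binomial_fact_pow[of n s] by (metis of_nat_fact of_nat_le_iff of_nat_mult of_nat_power)
  ultimately have "real (n choose s) * fact s * (real s ^ s / fact s) \<le> real n ^ s * exp (real s)"
    by (intro mult_mono) auto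
  then have "real (n choose s) * real s ^ s \<le> real n ^ s * exp 1 ^ s"
    by (simp add: exp_of_nat_mult[symmetric])
  then show ?thesis using assms
    by (simp add: power_divide power_mult_distrib field_simps)
qed

text \<open>A set with at least \<open>s\<close> elements contains one with exactly
  \<open>s\<close>, so it suffices to sum the subset bound over the \<open>n choose s\<close> sets
  of that size.\<close>

lemma prob_card_ge:
  fixes B :: "'a \<Rightarrow> nat set"
  assumes B: "\<And>A. B A \<subseteq> {1..n}"
    and q: "0 < s" "\<And>S. S \<subseteq> {1..n} \<Longrightarrow> card S = s \<Longrightarrow> measure_pmf.prob M {A. S \<subseteq> B A} \<le> q ^ s"
    and q0: "0 \<le> q"
  shows "measure_pmf.prob M {A. s \<le> card (B A)} \<le> (exp 1 * real n * q / real s) ^ s"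
proof -
  let ?F = "{S. S \<subseteq> {1..n} \<and> card S = s}"
  have F: "finite ?F" by (rule finite_subset[of _ "Pow {1..n}"]) auto
  have "{A. s \<le> card (B A)} \<subseteq> (\<Union>S\<in>?F. {A. S \<subseteq> B A})"
  proof safe
    fix A assume "s \<le> card (B A)"
    then obtain S where "S \<subseteq> B A" "card S = s" by (meson obtain_subset_with_card_n)
    then show "A \<in> (\<Union>S\<in>?F. {A. S \<subseteq> B A})" using B[of A] by blast
  qed
  then have "measure_pmf.prob M {A. s \<le> card (B A)} \<le> measure_pmf.prob M (\<Union>S\<in>?F. {A. S \<subseteq> B A})"
    by (intro measure_pmf.finite_measure_mono) auto
  also have "\<dots> \<le> (\<Sum>S\<in>?F. measure_pmf.prob M {A. S \<subseteq> B A})"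
    by (rule measure_pmf.finite_measure_subadditive_finite[OF F]) auto
  also have "\<dots> \<le> (\<Sum>S\<in>?F. q ^ s)" using q by (intro sum_mono) auto
  also have "\<dots> = real (n choose s) * q ^ s" by (simp add: n_subsets)
  also have "\<dots> \<le> (exp 1 * real n / real s) ^ s * q ^ s"
    using choose_le_exp_power[OF q(1)] q0 by (intro mult_right_mono) auto
  also have "\<dots> = (exp 1 * real n * q / real s) ^ s"
    by (simp add: power_mult_distrib[symmetric])
  finally show ?thesis .
qed

section \<open>The equation \<open>x + ln x = K\<close>\<close>

text \<open>Exponentiating turns the equation into \<open>x * exp x = exp K\<close>, so
  \<open>x\<close> is the Lambert W function at \<open>exp K\<close>. Such solutions serve as
  \<open>ln u\<close> and \<open>ln v\<close> in the theorem.\<close>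

lemma ex_add_ln_eq: "\<exists>x>0. x + ln x = (K::real)"
proof -
  have "\<exists>x\<ge>0. x \<le> exp K \<and> x * exp x = exp K"
  proof (rule IVT)
    have "exp K * 1 \<le> exp K * exp (exp K)" by (intro mult_left_mono) auto
    then show "exp K \<le> exp K * exp (exp K)" by simp
  qed (auto intro!: continuous_intros)
  then obtain x where x: "x \<ge> 0" "x * exp x = exp K" by blast
  then have "x > 0" by (cases "x = 0") auto
  moreover from this have "ln (x * exp x) = ln x + x" by (simp add: ln_mult)
  ultimately show ?thesis using x(2) by (metis add.commute ln_exp)
qed

text \<open>Since \<open>ln x \<le> x - 1\<close>, half of \<open>x + ln x\<close> is a lower bound
  for \<open>x\<close>.\<close>

lemma filterlim_add_ln_imp_at_top:
  fixes x :: "nat \<Rightarrow> real"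
  assumes pos: "eventually (\<lambda>n. x n > 0) F" and lim: "filterlim (\<lambda>n. x n + ln (x n)) at_top F"
  shows "filterlim x at_top F"
proof -
  have "eventually (\<lambda>n. (x n + ln (x n)) / 2 \<le> x n) F"
    using pos by eventually_elim (use ln_le_minus_one in fastforce)
  moreover have "filterlim (\<lambda>n. (x n + ln (x n)) / 2) at_top F"
    using filterlim_tendsto_pos_mult_at_top[OF tendsto_const _ lim, of "1 / 2"] by simp
  ultimately show ?thesis by (rule filterlim_at_top_mono[rotated])
qed

section \<open>Initial labelings: overlap counts, number and existence\<close>

text \<open>With \<open>m = n div 2\<close>, each pair of true and initial label occurs
  \<open>\<gamma> * m\<close> times if the two agree and \<open>(1 - \<gamma>) * m\<close> times
  otherwise. This evaluates the confusion matrix, the Chernoff exponent of a row and the weights in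
  the entropy count.\<close>

lemma sum_over_labeling:
  fixes f :: "nat \<Rightarrow> nat \<Rightarrow> real"
  assumes e: "e \<in> initial_labelings \<gamma> n" and "even n"
  shows "(\<Sum>j=1..n. f (true_label n j) (e j)) =
    real (n div 2) * (\<gamma> * (f 1 1 + f 2 2) + (1 - \<gamma>) * (f 1 2 + f 2 1))"
proof -
  let ?m = "n div 2"
  have e12: "e j = 1 \<or> e j = 2" if "j \<in> {1..n}" for j
    using e that by (auto simp: initial_labelings_def PiE_iff)
  have c1: "(\<Sum>j=1..?m. of_bool (e j = 1)) = \<gamma> * real ?m"
    and c2: "(\<Sum>j=?m + 1..n. of_bool (e j = 2)) = \<gamma> * real ?m"
    using e by (auto simp: initial_labelings_def)
  have n: "n = ?m + ?m" using \<open>even n\<close> by presburger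
  then have *: "{1..n} = {1..?m} \<union> {?m + 1..n}" by auto
  have "(\<Sum>j=1..n. f (true_label n j) (e j)) =
      (\<Sum>j=1..?m. f (true_label n j) (e j)) + (\<Sum>j=?m + 1..n. f (true_label n j) (e j))"
    unfolding * by (intro sum.union_disjoint) auto
  also have "(\<Sum>j=1..?m. f (true_label n j) (e j)) =
      (\<Sum>j=1..?m. f 1 2 + of_bool (e j = 1) * (f 1 1 - f 1 2))"
  proof (intro sum.cong refl)
    fix j assume "j \<in> {1..?m}"
    then show "f (true_label n j) (e j) = f 1 2 + of_bool (e j = 1) * (f 1 1 - f 1 2)"
      using e12[of j] n by (auto simp: true_label_def)
  qed
  also have "\<dots> = real ?m * f 1 2 + \<gamma> * real ?m * (f 1 1 - f 1 2)"
    using c1 by (simp add: sum.distrib sum_distrib_right[symmetric] del: of_bool_eq_0_iff sum_of_bool_eq)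
  also have "(\<Sum>j=?m + 1..n. f (true_label n j) (e j)) =
      (\<Sum>j=?m + 1..n. f 2 1 + of_bool (e j = 2) * (f 2 2 - f 2 1))"
  proof (intro sum.cong refl)
    fix j assume "j \<in> {?m + 1..n}"
    then show "f (true_label n j) (e j) = f 2 1 + of_bool (e j = 2) * (f 2 2 - f 2 1)"
      using e12[of j] n by (auto simp: true_label_def)
  qed
  also have "\<dots> = real ?m * f 2 1 + \<gamma> * real ?m * (f 2 2 - f 2 1)"
  proof -
    have "n - ?m = ?m" using n by presburger
    then show ?thesis
      using c2 by (simp add: sum.distrib sum_distrib_right[symmetric] del: of_bool_eq_0_iff sum_of_bool_eq)
  qed
  finally show ?thesis by (simp add: algebra_simps)
qed

text \<open>Let every node keep its true label with probability \<open>\<gamma>\<close>,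
  independently. All initial labelings then have the same probability \<open>exp (- n * h)\<close>,
  where \<open>h\<close> is the binary entropy of \<open>\<gamma>\<close>, and these probabilities
  sum to at most 1.\<close>

lemma card_initial_labelings_le:
  assumes \<gamma>: "0 < \<gamma>" "\<gamma> < 1" and "even n"
  shows "real (card (initial_labelings \<gamma> n)) \<le> exp (real n * binary_entropy \<gamma>)"
proof -
  let ?c = "true_label n"
  define w where "w = (\<lambda>k l :: nat. if l = k then \<gamma> else 1 - \<gamma>)"
  have w: "0 < w k l" for k l using \<gamma> by (auto simp: w_def)
  have fin: "finite ({1..n} \<rightarrow>\<^sub>E {1, 2 :: nat})" by (intro finite_PiE) auto
  have n: "real n = 2 * real (n div 2)" using \<open>even n\<close> by (metis dvd_mult_div_cancel of_nat_mult of_nat_numeral)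
  have "(\<Prod>i=1..n. w (?c i) (e i)) = exp (- real n * binary_entropy \<gamma>)"
    if e: "e \<in> initial_labelings \<gamma> n" for e
  proof -
    have "(\<Prod>i=1..n. w (?c i) (e i)) = (\<Prod>i=1..n. exp (ln (w (?c i) (e i))))"
      using w by simp
    also have "\<dots> = exp (\<Sum>i=1..n. ln (w (?c i) (e i)))" by (simp add: exp_sum)
    also have "(\<Sum>i=1..n. ln (w (?c i) (e i))) = - real n * binary_entropy \<gamma>"
      by (subst sum_over_labeling[OF e \<open>even n\<close>]) (simp add: w_def binary_entropy_def n algebra_simps)
    finally show ?thesis .
  qed
  then have "real (card (initial_labelings \<gamma> n)) * exp (- real n * binary_entropy \<gamma>) =
      (\<Sum>e\<in>initial_labelings \<gamma> n. \<Prod>i=1..n. w (?c i) (e i))"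
    by simp
  also have "\<dots> \<le> (\<Sum>e\<in>{1..n} \<rightarrow>\<^sub>E {1, 2}. \<Prod>i=1..n. w (?c i) (e i))"
    using w fin by (intro sum_mono2 prod_nonneg) (auto simp: initial_labelings_def less_imp_le)
  also have "\<dots> = (\<Prod>i=1..n. \<Sum>l\<in>{1, 2}. w (?c i) l)"
    by (rule prod_sum_PiE[symmetric]) auto
  also have "\<dots> = 1" by (intro prod.neutral) (auto simp: w_def true_label_def)
  finally show ?thesis by (simp add: exp_minus field_simps)
qed

lemma finite_initial_labelings: "finite (initial_labelings \<gamma> n)"
  by (rule finite_subset[of _ "{1..n} \<rightarrow>\<^sub>E {1, 2}"]) (auto simp: initial_labelings_def intro!: finite_PiE)

text \<open>Keeps the supremum and the maximum over initial labelings away from the empty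
  set.\<close>

lemma initial_labelings_nonempty:
  assumes "n \<in> sizes \<gamma>" "0 < \<gamma>" "\<gamma> < 1"
  shows "initial_labelings \<gamma> n \<noteq> {}"
proof -
  define m where "m = n div 2"
  have n: "n = m + m" using assms(1) by (auto simp: sizes_def m_def)
  obtain z where z: "\<gamma> * real m = of_int z" using assms(1) by (auto simp: sizes_def m_def Ints_def)
  define k where "k = nat z"
  have "0 \<le> \<gamma> * real m" using assms by simp
  then have k: "real k = \<gamma> * real m" using z by (simp add: k_def)
  have "real k \<le> real m" using assms(2,3) by (simp add: k mult_left_le_one_le)
  then have km: "k \<le> m" by simp
  \<comment> \<open>The first \<open>k\<close> nodes of each block keep their true label; all others
    are flipped.\<close>
  define e :: "nat \<Rightarrow> nat" where "e = (\<lambda>i\<in>{1..n}. if i \<le> k \<or> m + k < i then 1 else 2)"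
  have "{i \<in> {1..m}. e i = 1} = {1..k}" using km n by (auto simp: e_def)
  then have 1: "(\<Sum>i=1..m. of_bool (e i = 1)) = real k" by (simp add: sum_of_bool_eq Int_def)
  have "{i \<in> {m + 1..n}. e i = 2} = {m + 1..m + k}" using km n by (auto simp: e_def)
  then have 2: "(\<Sum>i=m + 1..n. of_bool (e i = 2)) = real k" by (simp add: sum_of_bool_eq Int_def)
  have "e \<in> {1..n} \<rightarrow>\<^sub>E {1, 2}" by (auto simp: e_def)
  then have "e \<in> initial_labelings \<gamma> n"
    using 1 2 k unfolding initial_labelings_def m_def[symmetric] by simp
  then show ?thesis by blast
qed

section \<open>From CPL errors to misled nodes\<close>

text \<open>Ties count as misled, so that the set covers the errors under every way of breaking
  ties. It is free of \<open>ah\<close> and \<open>bh\<close>, which makes the bounds uniform over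
  the estimates.\<close>

definition misled :: "nat \<Rightarrow> (nat \<Rightarrow> nat) \<Rightarrow> (nat \<Rightarrow> nat) \<Rightarrow> adjacency \<Rightarrow> nat set" where
  "misled n c e A =
     {i \<in> {1..n}. 0 \<le> (\<Sum>j=1..n. (if e j = c i then 1 else -1) * real (A i j))}"

text \<open>The difference has the factor \<open>2 * m - ah - bh\<close> with
  \<open>m = n div 2\<close>, positive because \<open>bh < ah \<le> m\<close>. The estimated edge
  probabilities are thus ordered like the estimates.\<close>

lemma edge_prob_less:
  assumes "0 < real (n div 2)" "ah \<le> real (n div 2)" "bh < ah"
  shows "edge_prob n ah bh 1 2 < edge_prob n ah bh 1 1"
proof -
  let ?m = "real (n div 2)"
  have "edge_prob n ah bh 1 1 - edge_prob n ah bh 1 2 = (ah - bh) * (2 * ?m - ah - bh) / ?m\<^sup>2"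
    using assms by (simp add: edge_prob_def two_block_def Let_def field_simps power2_eq_square)
  moreover have "\<dots> > 0" using assms by (intro divide_pos_pos mult_pos_pos) auto
  ultimately show ?thesis by linarith
qed

lemma edge_prob_swap: "edge_prob n a b 1 1 = edge_prob n b a 1 2"
  "edge_prob n a b 2 2 = edge_prob n a b 1 1" "edge_prob n a b 2 1 = edge_prob n a b 1 2"
  by (auto simp: edge_prob_def two_block_def)

lemma edge_prob_bounds:
  assumes "0 < n div 2" "a \<in> {0..real (n div 2)}" "b \<in> {0..real (n div 2)}"
  shows "0 \<le> edge_prob n a b k l" "edge_prob n a b k l \<le> 1"
proof -
  let ?m = "real (n div 2)"
  define x where "x = (if k = l then a else b)"
  have x: "0 \<le> x" "x \<le> ?m" using assms by (auto simp: x_def)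
  have m: "0 < ?m" using assms by simp
  have eq: "edge_prob n a b k l = x * (2 * ?m - x) / ?m\<^sup>2" "edge_prob n a b k l = 1 - ((?m - x) / ?m)\<^sup>2"
    using m by (auto simp: edge_prob_def two_block_def Let_def x_def field_simps power2_eq_square)
  show "0 \<le> edge_prob n a b k l" unfolding eq(1) using x by simp
  show "edge_prob n a b k l \<le> 1" unfolding eq(2) by simp
qed

text \<open>Since \<open>(1 - 2 * \<gamma>) * (ah - bh) > 0\<close>, the diagonal of the estimated rate matrix is the smaller
  one, so a node is assigned to the class opposite to the initial label that dominates among its
  neighbours, whatever the values of \<open>ah\<close> and \<open>bh\<close>.\<close>

lemma cpl_error_imp_misled:
  assumes \<gamma>: "0 < \<gamma>" "\<gamma> < 1" and n: "even n" "0 < n"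
    and ab: "0 < (1 - 2 * \<gamma>) * (a - b)"
    and est: "(ah, bh) \<in> param_estimates n a b" and e: "e \<in> initial_labelings \<gamma> n"
    and ch: "ch \<in> cpl_labelings n (true_label n) A ah bh e"
    and i: "i \<in> {1..n}" "ch i \<noteq> true_label n i"
  shows "i \<in> misled n (true_label n) e A"
proof -
  let ?c = "true_label n" and ?m = "real (n div 2)"
  define p where "p = edge_prob n ah bh 1 1"
  define q where "q = edge_prob n ah bh 1 2"
  have m: "0 < ?m" "0 < n div 2" using n by auto
  have hat: "ah \<in> {0..?m}" "bh \<in> {0..?m}" "0 < (ah - bh) * (a - b)"
    using est by (auto simp: param_estimates_def)
  have p0: "0 \<le> p" "0 \<le> q" unfolding p_def q_def using edge_prob_bounds[OF m(2) hat(1,2)] by auto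
  have pq: "0 < (1 - 2 * \<gamma>) * (p - q)"
  proof (cases "bh < ah")
    case True
    then have "0 < 1 - 2 * \<gamma>" "q < p"
      using hat ab edge_prob_less[of n ah bh] m by (auto simp: p_def q_def zero_less_mult_iff)
    then show ?thesis by simp
  next
    case False
    then have "ah < bh" using hat by (cases "ah = bh") auto
    then have "1 - 2 * \<gamma> < 0" "p < q"
      using hat ab edge_prob_less[of n bh ah] m
      unfolding p_def q_def by (auto simp: zero_less_mult_iff edge_prob_swap(1)[of n bh ah] edge_prob_swap(1)[of n ah bh]
          simp del: One_nat_def)
    then show ?thesis by (simp add: zero_less_mult_iff)
  qed
  \<comment> \<open>\<open>s\<close> and \<open>t\<close> are the diagonal and off-diagonal entries
    of \<open>theta_hat\<close>.\<close>
  define s where "s = (\<gamma> * p + (1 - \<gamma>) * q) / (p + q)"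
  define t where "t = ((1 - \<gamma>) * p + \<gamma> * q) / (p + q)"
  have sum_pos: "0 < p + q" using p0 pq by (cases "p = 0"; cases "q = 0") auto
  \<comment> \<open>Strict positivity of \<open>s\<close> keeps the comparison of
    \<open>ln s\<close> with \<open>ln t\<close> in the range where \<open>ln\<close> is
    monotone.\<close>
  have mixpos: "0 < \<gamma> * p + (1 - \<gamma>) * q"
    using \<gamma> p0 sum_pos by (cases "p = 0") (auto intro: add_pos_nonneg)
  have "\<gamma> * p + (1 - \<gamma>) * q < (1 - \<gamma>) * p + \<gamma> * q" using pq by (simp add: algebra_simps)
  then have s: "0 < s" "s < t"
    unfolding s_def t_def using sum_pos mixpos by (simp_all add: divide_strict_right_mono)
  have conf: "real n * confusion n ?c e k l = (if k = l then \<gamma> * ?m else (1 - \<gamma>) * ?m)"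
    if "k \<in> {1, 2}" "l \<in> {1, 2}" for k l
  proof -
    have "real n * confusion n ?c e k l = (\<Sum>j=1..n. of_bool (e j = k \<and> ?c j = l))"
      using n by (simp add: confusion_def)
    also have "\<dots> = ?m * (\<gamma> * (of_bool (1 = k \<and> 1 = l) + of_bool (2 = k \<and> 2 = l))
        + (1 - \<gamma>) * (of_bool (2 = k \<and> 1 = l) + of_bool (1 = k \<and> 2 = l)))"
      by (rule sum_over_labeling[OF e n(1), where f = "\<lambda>x y. of_bool (y = k \<and> x = l)"])
    also have "\<dots> = (if k = l then \<gamma> * ?m else (1 - \<gamma>) * ?m)"
      using that by (elim insertE emptyE) simp_all
    finally show ?thesis .
  qed
  have rate: "rate_matrix n ?c e (edge_prob n ah bh) k l =
      ?m * (if k = l then \<gamma> * p + (1 - \<gamma>) * q else (1 - \<gamma>) * p + \<gamma> * q)"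
    if "k \<in> {1, 2}" "l \<in> {1, 2}" for k l
    using that unfolding rate_matrix_def
    by (elim insertE emptyE) (simp_all add: conf p_def q_def edge_prob_swap(2,3) algebra_simps del: One_nat_def)
  have rate_sum: "(\<Sum>l\<in>{1, 2}. rate_matrix n ?c e (edge_prob n ah bh) k l) = ?m * (p + q)"
    if "k \<in> {1, 2}" for k
    using that by (elim insertE emptyE) (simp_all add: rate algebra_simps del: One_nat_def)
  have theta: "theta_hat n ?c e ah bh k l = (if k = l then s else t)"
    if "k \<in> {1, 2}" "l \<in> {1, 2}" for k l
    unfolding theta_hat_def rate_sum[OF that(1)] rate[OF that] using m by (simp add: s_def t_def)
  define k where "k = ch i"
  have arg: "is_arg_max (cpl_score n ?c A ah bh e i) (\<lambda>k. k \<in> {1, 2}) k"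
    using ch i(1) by (auto simp: cpl_labelings_def k_def)
  have ci: "?c i \<in> {1, 2}" by (auto simp: true_label_def)
  have k: "k \<in> {1, 2}" using arg by (simp add: is_arg_max_linorder)
  have ne: "k \<noteq> ?c i" using i(2) by (simp add: k_def)
  have "cpl_score n ?c A ah bh e i (?c i) \<le> cpl_score n ?c A ah bh e i k"
    using arg ci unfolding is_arg_max_linorder by blast
  \<comment> \<open>The priors agree and the two classes exchange \<open>s\<close> and
    \<open>t\<close>, so the score difference factors into the vote difference times
    \<open>ln t - ln s\<close>.\<close>
  then have "0 \<le> (real (block_sum n A e i (?c i)) - real (block_sum n A e i k)) * (ln t - ln s)"
    using ci k ne unfolding cpl_score_def
    by (elim insertE emptyE) (simp_all add: class_prior_def theta algebra_simps del: One_nat_def)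
  moreover have "0 < ln t - ln s" using s by simp
  ultimately have "0 \<le> real (block_sum n A e i (?c i)) - real (block_sum n A e i k)"
    by (simp add: zero_le_mult_iff)
  also have "\<dots> = (\<Sum>j=1..n. real (A i j) * of_bool (e j = ?c i) - real (A i j) * of_bool (e j = k))"
    by (simp add: block_sum_def sum_subtractf)
  also have "\<dots> = (\<Sum>j=1..n. (if e j = ?c i then 1 else -1) * real (A i j))"
  proof (intro sum.cong refl)
    fix j assume "j \<in> {1..n}"
    then have "e j \<in> {1, 2}" using e by (auto simp: initial_labelings_def PiE_iff)
    then show "real (A i j) * of_bool (e j = ?c i) - real (A i j) * of_bool (e j = k) =
        (if e j = ?c i then 1 else -1) * real (A i j)"
      using ci k ne by auto
  qed
  finally show ?thesis using i(1) by (simp add: misled_def)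
qed

text \<open>The minimum over relabelings is at most its value at the identity.\<close>

lemma mismatch_le:
  assumes "{i \<in> {1..n}. ch i \<noteq> c i} \<subseteq> B" "finite B"
  shows "mismatch n c ch \<le> real (card B) / real n"
proof -
  have "{\<phi>. \<phi> permutes {1, 2::nat}} = {id, Transposition.transpose 1 2}"
    by (auto simp: permutes_doubleton_iff)
  then have "mismatch n c ch \<le> 1 / real n * (\<Sum>i=1..n. of_bool (ch i \<noteq> id (c i)))"
    unfolding mismatch_def by (intro Min_le) auto
  also have "\<dots> = real (card {i \<in> {1..n}. ch i \<noteq> c i}) / real n"
    by (simp add: sum_of_bool_eq Int_def)
  also have "\<dots> \<le> real (card B) / real n"
    using assms by (intro divide_right_mono of_nat_mono card_mono) auto
  finally show ?thesis .
qed

section \<open>The Chernoff exponent\<close>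

text \<open>The left side is the log moment generating function of a difference of independent
  Poisson variables with means \<open>\<alpha>\<close> and \<open>\<beta>\<close>. It is minimal at
  \<open>exp \<mu> = sqrt (\<beta> / \<alpha>)\<close>, with value
  \<open>- (sqrt \<beta> - sqrt \<alpha>)\<^sup>2\<close>;
  \<open>(x + y)\<^sup>2 \<le> 2 * (x\<^sup>2 + y\<^sup>2)\<close> turns this into the stated
  form.\<close>

lemma ex_exp_tilt:
  assumes "0 < \<alpha>" "\<alpha> \<le> (\<beta>::real)"
  shows "\<exists>\<mu>\<ge>0. \<alpha> * (exp \<mu> - 1) + \<beta> * (exp (- \<mu>) - 1) \<le> - ((\<beta> - \<alpha>)\<^sup>2 / (2 * (\<alpha> + \<beta>)))"
proof -
  define x where "x = sqrt \<alpha>"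
  define y where "y = sqrt \<beta>"
  have x: "0 < x" "x \<le> y" "\<alpha> = x\<^sup>2" "\<beta> = y\<^sup>2" using assms by (auto simp: x_def y_def)
  define \<mu> where "\<mu> = ln (y / x)"
  have \<mu>: "exp \<mu> = y / x" "exp (- \<mu>) = x / y" using x by (auto simp: \<mu>_def exp_minus)
  have "(\<beta> - \<alpha>)\<^sup>2 = (y - x)\<^sup>2 * (y + x)\<^sup>2" by (simp add: x algebra_simps power2_eq_square)
  also have "\<dots> \<le> (y - x)\<^sup>2 * (2 * (\<alpha> + \<beta>))"
    using sum_squares_bound[of y x] by (intro mult_left_mono) (auto simp: x power2_sum)
  finally have "(\<beta> - \<alpha>)\<^sup>2 / (2 * (\<alpha> + \<beta>)) \<le> (y - x)\<^sup>2"
    using assms by (simp add: divide_le_eq)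
  moreover have "\<alpha> * (exp \<mu> - 1) + \<beta> * (exp (- \<mu>) - 1) = - (y - x)\<^sup>2"
    using x by (simp add: \<mu> field_simps power2_eq_square)
  moreover have "0 \<le> \<mu>" using x by (simp add: \<mu>_def)
  ultimately show ?thesis by (intro exI[of _ \<mu>]) auto
qed

text \<open>Equals \<open>m / 2\<close> times the edge probability \<open>2 * x / m - x\<^sup>2 / m\<^sup>2\<close>, where \<open>m = n div 2\<close>.\<close>

definition half_rate :: "nat \<Rightarrow> real \<Rightarrow> real" where
  "half_rate n x = x - x\<^sup>2 / (2 * real (n div 2))"

lemma half_rate_nonneg:
  assumes "x \<in> {0..real (n div 2)}"
  shows "0 \<le> half_rate n x" "x / 2 \<le> half_rate n x"
proof -
  have "x\<^sup>2 \<le> x * real (n div 2)" using assms by (auto simp: power2_eq_square mult_left_mono)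
  then show "x / 2 \<le> half_rate n x"
    using assms by (cases "n div 2 = 0") (auto simp: half_rate_def field_simps)
  with assms show "0 \<le> half_rate n x" by auto
qed

lemma half_rate_diff:
  "half_rate n x - half_rate n y = (x - y) * (1 - (x + y) / (2 * real (n div 2)))"
proof -
  define k where "k = 1 / (2 * real (n div 2))"
  have "z / (2 * real (n div 2)) = z * k" for z by (simp add: k_def)
  then show ?thesis unfolding half_rate_def by (simp add: algebra_simps power2_eq_square)
qed

text \<open>Here \<open>r\<close> and \<open>t\<close> stand for \<open>b / a\<close> and \<open>a / m\<close>.  The hypothesis on \<open>\<epsilon>\<close> forces \<open>2 * r \<le> \<epsilon>\<close>, which
  pays for the quadratic correction in the edge probabilities even in the dense case \<open>t = 1\<close>.\<close>

lemma sparsity_polynomial_le: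
  fixes r t \<epsilon> :: real
  assumes r: "0 \<le> r" "2 * r \<le> \<epsilon>" and "\<epsilon> < 1" and t: "0 \<le> t" "t \<le> 1"
  shows "(1 - \<epsilon>)\<^sup>2 * (1 + r - (1 + r\<^sup>2) * t / 2) \<le> 2 * (1 - t * (1 + r) / 2)\<^sup>2 * (1 + r)"
proof -
  have r': "r \<le> 1 / 2" using assms by simp
  have r2: "r\<^sup>2 \<le> r" using r r' by (simp add: power2_eq_square mult_left_le)
  have s: "t * (1 + r) \<le> 1 + r" using r t by (simp add: mult_left_le_one_le)
  have aux: "1 - r \<le> 2 * (1 - w / 2)" "0 \<le> 1 - w / 2" if "w \<le> 1 + r" for w
    using that r' by auto
  have "(1 + r\<^sup>2) * t \<le> 1 + r\<^sup>2" using t by (simp add: mult_left_le)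
  then have pos: "0 \<le> 1 + r - (1 + r\<^sup>2) * t / 2" using r r2 r' by simp
  have "(1 - \<epsilon>)\<^sup>2 \<le> (1 - 2 * r)\<^sup>2" using assms by (intro power_mono) auto
  then have "(1 - \<epsilon>)\<^sup>2 * (1 + r - (1 + r\<^sup>2) * t / 2) \<le> (1 - 2 * r)\<^sup>2 * (1 + r - (1 + r\<^sup>2) * t / 2)"
    using pos by (rule mult_right_mono)
  also have "\<dots> \<le> (1 - t * (1 + r) / 2) * (1 - r\<^sup>2)"
  proof -
    \<comment> \<open>The difference of the two sides is affine in \<open>t\<close>. It is written
      as the interpolation, with weights \<open>1 - t\<close> and \<open>t\<close>, between its
      values at \<open>t = 0\<close> and \<open>t = 1\<close>, each nonnegative for
      \<open>0 \<le> r \<le> 1 / 2\<close>.\<close>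
    have "0 \<le> (1 - t) * (r * (1 + r) * (3 - 4 * r))"
      using r r' t by (intro mult_nonneg_nonneg) auto
    moreover have "0 \<le> 1 + 4 * r - 11 * r\<^sup>2 + 4 * r ^ 3"
    proof -
      have "r * r \<le> 1 / 2 * r" using r r' by (intro mult_right_mono)
      then have "11 * r\<^sup>2 \<le> 11 / 2 * r" by (simp add: power2_eq_square)
      moreover have "0 \<le> r ^ 3" using r by simp
      ultimately show ?thesis using r r' by linarith
    qed
    then have "0 \<le> t * (r * (1 + 4 * r - 11 * r\<^sup>2 + 4 * r ^ 3) / 2)"
      using r t by (intro mult_nonneg_nonneg divide_nonneg_nonneg) auto
    ultimately have "0 \<le> (1 - t) * (r * (1 + r) * (3 - 4 * r)) + t * (r * (1 + 4 * r - 11 * r\<^sup>2 + 4 * r ^ 3) / 2)"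
      by (rule add_nonneg_nonneg)
    also have "\<dots> = (1 - t * (1 + r) / 2) * (1 - r\<^sup>2) - (1 - 2 * r)\<^sup>2 * (1 + r - (1 + r\<^sup>2) * t / 2)"
      by (simp add: field_simps power2_eq_square power3_eq_cube)
    finally show ?thesis by simp
  qed
  also have "\<dots> = (1 - t * (1 + r) / 2) * ((1 - r) * (1 + r))"
    by (simp add: power2_eq_square algebra_simps)
  also have "\<dots> \<le> (1 - t * (1 + r) / 2) * (2 * (1 - t * (1 + r) / 2) * (1 + r))"
    using aux[OF s] r by (intro mult_left_mono mult_right_mono) auto
  also have "\<dots> = 2 * (1 - t * (1 + r) / 2)\<^sup>2 * (1 + r)"
    unfolding power2_eq_square by (simp only: mult_ac)
  finally show ?thesis .
qed

text \<open>After the factor \<open>(a - b)\<^sup>2\<close> is split off by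
  \<open>half_rate_diff\<close>, the claim in the scale-free variables \<open>r\<close> and
  \<open>t\<close> is the preceding polynomial inequality.\<close>

lemma half_rate_signal_ge_ordered:
  fixes a b :: real
  assumes b: "0 \<le> b" "2 * b \<le> \<epsilon> * a" and "b < a" "a \<le> real (n div 2)" and \<epsilon>: "\<epsilon> < 1"
  shows "1 / 4 * (1 - \<epsilon>)\<^sup>2 * tau_sq a b
    \<le> (half_rate n a - half_rate n b)\<^sup>2 / (2 * (half_rate n a + half_rate n b))"
proof -
  define m where "m = real (n div 2)"
  define r where "r = b / a"
  define t where "t = a / m"
  have a: "0 < a" "a \<le> m" using assms by (auto simp: m_def)
  then have m: "0 < m" by simp
  have ab: "a = m * t" "b = m * t * r" using a m by (auto simp: r_def t_def)
  have t: "0 < t" "t \<le> 1" using a m by (auto simp: t_def)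
  have r: "0 \<le> r" "2 * r \<le> \<epsilon>" using a b by (auto simp: r_def divide_simps)
  have sum: "half_rate n a + half_rate n b = m * t * (1 + r - (1 + r\<^sup>2) * t / 2)"
    using m by (simp add: half_rate_def m_def[symmetric] ab field_simps power2_eq_square)
  have s: "(a + b) / (2 * m) = t * (1 + r) / 2"
    using m by (simp add: ab field_simps)
  have "half_rate n a > 0"
    using half_rate_nonneg[of a n] a by (auto simp: m_def)
  moreover have "0 \<le> half_rate n b"
    using half_rate_nonneg[of b n] assms by auto
  ultimately have pos: "0 < half_rate n a + half_rate n b" by simp
  have "(1 - \<epsilon>)\<^sup>2 * (half_rate n a + half_rate n b) \<le> 2 * (1 - (a + b) / (2 * m))\<^sup>2 * (a + b)"
  proof -
    have "m * t * ((1 - \<epsilon>)\<^sup>2 * (1 + r - (1 + r\<^sup>2) * t / 2)) \<le> m * t * (2 * (1 - t * (1 + r) / 2)\<^sup>2 * (1 + r))"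
      using sparsity_polynomial_le[OF r \<epsilon>, of t] t m by (intro mult_left_mono) auto
    moreover have "a + b = m * t * (1 + r)" by (simp add: ab algebra_simps)
    ultimately show ?thesis unfolding sum s by (simp add: mult.assoc mult.left_commute)
  qed
  then have "(a - b)\<^sup>2 * ((1 - \<epsilon>)\<^sup>2 * (half_rate n a + half_rate n b))
      \<le> (a - b)\<^sup>2 * (2 * (1 - (a + b) / (2 * m))\<^sup>2 * (a + b))"
    by (rule mult_left_mono) simp
  also have "\<dots> = 2 * (a + b) * (half_rate n a - half_rate n b)\<^sup>2"
    by (simp add: half_rate_diff m_def[symmetric] power_mult_distrib)
  finally have le: "(a - b)\<^sup>2 * ((1 - \<epsilon>)\<^sup>2 * (half_rate n a + half_rate n b))
      \<le> 2 * (a + b) * (half_rate n a - half_rate n b)\<^sup>2" .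
  have frac: "1 / 4 * K * (D / T) \<le> N / (2 * S)" if "D * (K * S) \<le> 2 * T * N" "0 < S" "0 < T" for D K S T N :: real
    using that by (simp add: field_simps)
  show ?thesis
    unfolding tau_sq_def using le pos a b by (intro frac) auto
qed

text \<open>Hypotheses and conclusion are invariant under replacing \<open>\<gamma>, a, b\<close> by
  \<open>1 - \<gamma>, b, a\<close>, which reduces the claim to the ordered case. The right side is
  the exponent that the Chernoff bound delivers, the left side the one in the condition on
  \<open>u\<close>.\<close>

lemma half_rate_signal_ge:
  assumes \<gamma>: "0 < \<gamma>" "\<gamma> < 1" and \<epsilon>: "0 < \<epsilon>" "\<epsilon> < 1"
    and ab: "a \<in> {0..real (n div 2)}" "b \<in> {0..real (n div 2)}" and pos: "0 < (1 - 2 * \<gamma>) * (a - b)"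
    and sig: "2 * (1 + \<epsilon>) * mix \<gamma> a b \<le> \<epsilon> * (1 - 2 * \<gamma>) * (a - b)"
  shows "1 / 4 * ((1 - \<epsilon>) * (1 - 2 * \<gamma>))\<^sup>2 * tau_sq a b
    \<le> ((1 - 2 * \<gamma>) * (half_rate n a - half_rate n b))\<^sup>2 / (2 * (half_rate n a + half_rate n b))"
proof -
  \<comment> \<open>The signal condition bounds the ratio of the parameters: drop
    \<open>g * x\<close> on the left, use \<open>1 - 2 * g \<le> 1 - g\<close> on the right, and
    cancel \<open>1 - g\<close>.\<close>
  have small: "2 * y \<le> \<epsilon> * x"
    if "0 < g" "g < 1" "0 < 1 - 2 * g" "0 \<le> x" "0 \<le> y"
      "2 * (1 + \<epsilon>) * (g * x + (1 - g) * y) \<le> \<epsilon> * (1 - 2 * g) * (x - y)" for g x y :: real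
  proof -
    have "0 \<le> g * x" using that by simp
    then have "2 * (1 - g) * y \<le> 2 * (g * x + (1 - g) * y)" by (simp add: algebra_simps)
    also have "\<dots> \<le> 2 * (1 + \<epsilon>) * (g * x + (1 - g) * y)"
      using that \<epsilon> by (intro mult_right_mono add_nonneg_nonneg mult_nonneg_nonneg) auto
    also have "\<dots> \<le> \<epsilon> * (1 - 2 * g) * (x - y)" by (rule that)
    also have "\<dots> \<le> \<epsilon> * ((1 - g) * x)"
    proof -
      have "0 \<le> (1 - 2 * g) * y" using that by simp
      with \<open>0 \<le> g * x\<close> have "(1 - 2 * g) * (x - y) \<le> (1 - g) * x" by (simp add: algebra_simps)
      then show ?thesis unfolding mult.assoc using \<epsilon> by (intro mult_left_mono) auto
    qed
    finally have "(1 - g) * (2 * y) \<le> (1 - g) * (\<epsilon> * x)" by (simp add: mult_ac)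
    then show ?thesis using that by simp
  qed
  have "1 / 4 * (1 - \<epsilon>)\<^sup>2 * tau_sq a b
      \<le> (half_rate n a - half_rate n b)\<^sup>2 / (2 * (half_rate n a + half_rate n b))"
  proof (cases "b < a")
    case True
    then have "0 < 1 - 2 * \<gamma>" using pos by (simp add: zero_less_mult_iff)
    then have "2 * b \<le> \<epsilon> * a" using small[of \<gamma> a b] \<gamma> ab sig by (simp add: mix_def)
    then show ?thesis using half_rate_signal_ge_ordered[of b \<epsilon> a n] True ab \<epsilon> by simp
  next
    case False
    then have "a < b" "0 < 1 - 2 * (1 - \<gamma>)" using pos by (auto simp: zero_less_mult_iff)
    then have "2 * a \<le> \<epsilon> * b" using small[of "1 - \<gamma>" b a] \<gamma> ab sig by (simp add: mix_def algebra_simps)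
    then show ?thesis using half_rate_signal_ge_ordered[of a \<epsilon> b n] \<open>a < b\<close> ab \<epsilon>
      by (simp add: tau_sq_def power2_commute add.commute)
  qed
  then have "(1 - 2 * \<gamma>)\<^sup>2 * (1 / 4 * (1 - \<epsilon>)\<^sup>2 * tau_sq a b)
      \<le> (1 - 2 * \<gamma>)\<^sup>2 * ((half_rate n a - half_rate n b)\<^sup>2 / (2 * (half_rate n a + half_rate n b)))"
    by (rule mult_left_mono) simp
  then show ?thesis by (simp add: power_mult_distrib mult_ac)
qed

section \<open>Tail bounds for misled nodes and the worst mismatch\<close>

text \<open>If all of \<open>S\<close> is misled, the votes summed over the rows in \<open>S\<close>
  are nonnegative. Tilting all these rows by the same \<open>\<mu>\<close> costs a factor
  \<open>exp (- q)\<close> per row.\<close>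

lemma prob_subset_misled_le:
  assumes n: "even n" "0 < n" and \<gamma>: "0 < \<gamma>" "\<gamma> < 1"
    and ab: "a \<in> {0..real (n div 2)}" "b \<in> {0..real (n div 2)}" and pos: "0 < (1 - 2 * \<gamma>) * (a - b)"
    and e: "e \<in> initial_labelings \<gamma> n" and S: "S \<subseteq> {1..n}"
  shows "measure_pmf.prob (block_model n (true_label n) (edge_prob n a b)) {A. S \<subseteq> misled n (true_label n) e A}
    \<le> exp (- (((1 - 2 * \<gamma>) * (half_rate n a - half_rate n b))\<^sup>2 / (2 * (half_rate n a + half_rate n b)))) ^ card S"
proof -
  let ?c = "true_label n" and ?P = "edge_prob n a b" and ?m = "real (n div 2)"
  let ?M = "block_model n ?c ?P"
  define x where "x = half_rate n a"
  define y where "y = half_rate n b"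
  \<comment> \<open>\<open>2 * \<alpha>\<close> is the expected number of entries 1 in a row
    \<open>i\<close> at columns with \<open>e j = c i\<close>, and \<open>2 * \<beta>\<close> the
    expected number at the other columns.\<close>
  define \<alpha> where "\<alpha> = \<gamma> * x + (1 - \<gamma>) * y"
  define \<beta> where "\<beta> = (1 - \<gamma>) * x + \<gamma> * y"
  have m: "0 < ?m" "0 < n div 2" using n by auto
  have "a \<noteq> b" using pos by auto
  have x0: "0 \<le> x" "0 \<le> y" "a / 2 \<le> x" "b / 2 \<le> y"
    unfolding x_def y_def using half_rate_nonneg[OF ab(1)] half_rate_nonneg[OF ab(2)] by auto
  have "0 < x \<or> 0 < y" using x0 ab \<open>a \<noteq> b\<close> by (cases "a = 0") auto
  then have "0 < \<alpha>" using x0 \<gamma> by (auto simp: \<alpha>_def intro: add_pos_nonneg add_nonneg_pos)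
  have diff: "\<beta> - \<alpha> = (1 - 2 * \<gamma>) * (x - y)" by (simp add: \<alpha>_def \<beta>_def algebra_simps)
  also have "\<dots> = ((1 - 2 * \<gamma>) * (a - b)) * (1 - (a + b) / (2 * ?m))"
    by (simp add: x_def y_def half_rate_diff)
  also have "\<dots> \<ge> 0" using ab m by (intro mult_nonneg_nonneg less_imp_le[OF pos]) (auto simp: field_simps)
  finally have "\<alpha> \<le> \<beta>" by simp
  have sum: "\<alpha> + \<beta> = x + y" by (simp add: \<alpha>_def \<beta>_def algebra_simps)
  define q where "q = (\<beta> - \<alpha>)\<^sup>2 / (2 * (\<alpha> + \<beta>))"
  obtain \<mu> where \<mu>: "0 \<le> \<mu>" "\<alpha> * (exp \<mu> - 1) + \<beta> * (exp (- \<mu>) - 1) \<le> - q"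
    using ex_exp_tilt[OF \<open>0 < \<alpha>\<close> \<open>\<alpha> \<le> \<beta>\<close>] unfolding q_def by blast
  define w where "w = (\<lambda>i j. if e j = ?c i then 1 else -1 :: real)"
  \<comment> \<open>The tilt is halved because \<open>block_model_mgf_le\<close> doubles the
    weights. Rows outside \<open>S\<close> have weight 0 and contribute
    \<open>exp 0 - 1 = 0\<close>.\<close>
  define z where "z = (\<lambda>i j. if i \<in> S then \<mu> / 2 * w i j else 0)"
  have row: "(\<Sum>j=1..n. ?P (?c i) (?c j) / 2 * (exp (\<mu> * w i j) - 1)) \<le> - q" if "i \<in> {1..n}" for i
  proof -
    have rates: "?m * ?P 1 1 = 2 * x" "?m * ?P 1 2 = 2 * y"
      using m by (auto simp: edge_prob_def two_block_def x_def y_def half_rate_def Let_def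
          field_simps power2_eq_square)
    have ci: "?c i = 1 \<or> ?c i = 2" by (auto simp: true_label_def)
    have "(\<Sum>j=1..n. ?P (?c i) (?c j) / 2 * (exp (\<mu> * w i j) - 1)) =
        \<gamma> * (?m * ?P 1 1) / 2 * (exp \<mu> - 1) + \<gamma> * (?m * ?P 1 2) / 2 * (exp (- \<mu>) - 1)
        + (1 - \<gamma>) * (?m * ?P 1 1) / 2 * (exp (- \<mu>) - 1) + (1 - \<gamma>) * (?m * ?P 1 2) / 2 * (exp \<mu> - 1)"
      using ci unfolding w_def
      by (subst sum_over_labeling[OF e n(1), where
            f = "\<lambda>k l. ?P (?c i) k / 2 * (exp (\<mu> * (if l = ?c i then 1 else -1)) - 1)"])
         (auto simp: edge_prob_swap(2,3) field_simps simp del: One_nat_def)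
    also have "\<dots> = \<alpha> * (exp \<mu> - 1) + \<beta> * (exp (- \<mu>) - 1)"
      unfolding rates by (simp add: \<alpha>_def \<beta>_def field_simps)
    also note \<mu>(2)
    finally show ?thesis .
  qed
  have "measure_pmf.prob ?M {A. S \<subseteq> misled n ?c e A}
      \<le> (\<integral>A. exp (\<Sum>i=1..n. \<Sum>j=1..n. z i j * real (A i j)) \<partial>?M)"
  proof (rule prob_le_expectation[OF finite_set_block_model])
    fix A assume A: "A \<in> {A. S \<subseteq> misled n ?c e A}"
    have "0 \<le> (\<Sum>j=1..n. z i j * real (A i j))" for i
    proof (cases "i \<in> S")
      case True
      then have "0 \<le> \<mu> / 2 * (\<Sum>j=1..n. w i j * real (A i j))"
        using A \<mu> by (intro mult_nonneg_nonneg) (auto simp: misled_def w_def)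
      then show ?thesis using True by (simp add: z_def sum_distrib_left mult.assoc)
    qed (simp add: z_def)
    then show "1 \<le> exp (\<Sum>i=1..n. \<Sum>j=1..n. z i j * real (A i j))" by (simp add: sum_nonneg)
  qed simp
  also have "\<dots> \<le> exp (\<Sum>i=1..n. \<Sum>j=1..n. ?P (?c i) (?c j) / 2 * (exp (2 * z i j) - 1))"
    using edge_prob_bounds[OF m(2) ab] by (intro block_model_mgf_le) (auto simp: edge_prob_def two_block_def)
  also have "\<dots> \<le> exp (\<Sum>i=1..n. if i \<in> S then - q else 0)"
    unfolding exp_le_cancel_iff
  proof (rule sum_mono)
    fix i assume "i \<in> {1..n}"
    with row[OF this] show "(\<Sum>j=1..n. ?P (?c i) (?c j) / 2 * (exp (2 * z i j) - 1)) \<le> (if i \<in> S then - q else 0)"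
      by (auto simp: z_def)
  qed
  also have "(\<Sum>i=1..n. if i \<in> S then - q else 0) = real (card S) * (- q)"
    using S by (simp add: sum.If_cases Int_absorb1)
  also have "exp \<dots> = exp (- q) ^ card S" by (rule exp_of_nat_mult)
  finally show ?thesis by (simp add: q_def diff sum x_def y_def)
qed

text \<open>The bound by misled nodes does not involve the estimates, so only the finitely many
  initial labelings remain, and one of them attains the maximum.\<close>

lemma worst_mismatch_le:
  assumes n: "n \<in> sizes \<gamma>" and \<gamma>: "0 < \<gamma>" "\<gamma> < 1"
    and ab: "a \<in> {0..real (n div 2)}" "b \<in> {0..real (n div 2)}" and pos: "0 < (1 - 2 * \<gamma>) * (a - b)"
    and ch: "\<And>ah bh e. (ah, bh) \<in> param_estimates n a b \<Longrightarrow> e \<in> initial_labelings \<gamma> n \<Longrightarrow>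
      chat A ah bh e \<in> cpl_labelings n (true_label n) A ah bh e"
  shows "\<exists>e\<in>initial_labelings \<gamma> n.
    worst_mismatch \<gamma> n a b chat A \<le> real (card (misled n (true_label n) e A)) / real n"
proof -
  let ?E = "initial_labelings \<gamma> n" and ?c = "true_label n"
  define f where "f = (\<lambda>e. real (card (misled n ?c e A)) / real n)"
  have n': "even n" "0 < n" using n by (auto simp: sizes_def)
  have E: "finite ?E" "?E \<noteq> {}"
    using finite_initial_labelings initial_labelings_nonempty[OF n \<gamma>] by auto
  then have "Max (f ` ?E) \<in> f ` ?E" by (intro Max_in) auto
  then obtain e0 where e0: "e0 \<in> ?E" "Max (f ` ?E) = f e0" by blast
  have "a \<noteq> b" using pos by auto
  then have "0 < (a - b) * (a - b)" by (simp add: zero_less_mult_iff) linarith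
  \<comment> \<open>The true pair \<open>(a, b)\<close> is itself an admissible estimate.\<close>
  then have est: "param_estimates n a b \<noteq> {}" using ab by (auto simp: param_estimates_def)
  have "worst_mismatch \<gamma> n a b chat A \<le> f e0"
    unfolding worst_mismatch_def
  proof (intro cSUP_least[OF est], clarify, intro cSUP_least[OF E(2)])
    fix ah bh e assume *: "(ah, bh) \<in> param_estimates n a b" "e \<in> ?E"
    have "{i \<in> {1..n}. chat A ah bh e i \<noteq> ?c i} \<subseteq> misled n ?c e A"
      using cpl_error_imp_misled[OF \<gamma> n' pos * ch[OF *]] by blast
    then have "mismatch n ?c (chat A ah bh e) \<le> f e"
      unfolding f_def by (intro mismatch_le) (auto simp: misled_def)
    also have "\<dots> \<le> f e0" using * E by (simp flip: e0(2))
    finally show "mismatch n ?c (chat A ah bh e) \<le> f e0" .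
  qed
  then show ?thesis using e0 by (auto simp: f_def)
qed

lemma binary_entropy_pos:
  assumes "0 < \<gamma>" "\<gamma> < 1"
  shows "0 < binary_entropy \<gamma>"
proof -
  have "0 < - (\<gamma> * ln \<gamma>)" "0 < - ((1 - \<gamma>) * ln (1 - \<gamma>))"
    using assms by (auto simp: mult_pos_neg)
  then show ?thesis unfolding binary_entropy_def by simp
qed

text \<open>Here \<open>z\<close> stands for \<open>ln u\<close>. The 4 in the threshold yields
  \<open>exp (- 4 * n * h)\<close> for one labeling, and summing over at most
  \<open>exp (n * h)\<close> labelings leaves the exponent 3.\<close>

lemma worst_mismatch_tail:
  assumes n: "n \<in> sizes \<gamma>" and \<gamma>: "0 < \<gamma>" "\<gamma> < 1" and \<epsilon>: "0 < \<epsilon>" "\<epsilon> < 1"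
    and ab: "a \<in> {0..real (n div 2)}" "b \<in> {0..real (n div 2)}" and pos: "0 < (1 - 2 * \<gamma>) * (a - b)"
    and sig: "2 * (1 + \<epsilon>) * mix \<gamma> a b \<le> \<epsilon> * (1 - 2 * \<gamma>) * (a - b)"
    and ch: "\<And>A ah bh e. A \<in> set_pmf (block_model n (true_label n) (edge_prob n a b)) \<Longrightarrow>
      (ah, bh) \<in> param_estimates n a b \<Longrightarrow> e \<in> initial_labelings \<gamma> n \<Longrightarrow>
      chat A ah bh e \<in> cpl_labelings n (true_label n) A ah bh e"
    and z: "0 < z" "z + ln z = ln (4 / exp 1 * binary_entropy \<gamma>)
      + 1 / 4 * ((1 - \<epsilon>) * (1 - 2 * \<gamma>))\<^sup>2 * tau_sq a b"
    and T: "4 * binary_entropy \<gamma> / z \<le> T"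
  shows "measure_pmf.prob (block_model n (true_label n) (edge_prob n a b))
    {A. T \<le> worst_mismatch \<gamma> n a b chat A} \<le> exp (- 3 * real n * binary_entropy \<gamma>)"
proof -
  let ?E = "initial_labelings \<gamma> n" and ?c = "true_label n"
  let ?M = "block_model n ?c (edge_prob n a b)"
  define h where "h = binary_entropy \<gamma>"
  define q where "q = 1 / 4 * ((1 - \<epsilon>) * (1 - 2 * \<gamma>))\<^sup>2 * tau_sq a b"
  \<comment> \<open>\<open>x\<close> is the number of misled nodes at mismatch ratio
    \<open>4 * h / z\<close>. A count that reaches \<open>x\<close> also reaches its ceiling
    \<open>s\<close>, since counts are integers.\<close>
  define x where "x = 4 * h / z * real n"
  define s where "s = nat \<lceil>x\<rceil>"
  have h: "0 < h" using binary_entropy_pos[OF \<gamma>] by (simp add: h_def)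
  have n': "even n" "0 < n" using n by (auto simp: sizes_def)
  have x: "0 < x" using h z n' by (simp add: x_def)
  have s: "x \<le> real s" "0 < s" using x by (auto simp: s_def)
  \<comment> \<open>This is the equation for \<open>z\<close> in exponentiated form: the constant
    \<open>4 / exp 1\<close> combines the 4 of the threshold with the \<open>exp 1\<close> of the
    binomial estimate.\<close>
  have base: "exp 1 * real n * exp (- q) = x * exp (- z)"
  proof -
    have "exp (z + ln z) = exp (ln (4 / exp 1 * h) + q)" using z(2) by (simp add: h_def q_def)
    then have "exp z * z = 4 / exp 1 * h * exp q" using z(1) h by (simp add: exp_add)
    then show ?thesis using z(1) by (simp add: x_def exp_minus field_simps)
  qed
  have tail: "measure_pmf.prob ?M {A. s \<le> card (misled n ?c e A)} \<le> exp (- 4 * real n * h)" if e: "e \<in> ?E" for e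
  proof -
    have "measure_pmf.prob ?M {A. s \<le> card (misled n ?c e A)} \<le> (exp 1 * real n * exp (- q) / real s) ^ s"
    proof (rule prob_card_ge)
      fix S assume S: "S \<subseteq> {1..n}" "card S = s"
      note prob_subset_misled_le[OF n' \<gamma> ab pos e S(1)]
      also have "exp (- (((1 - 2 * \<gamma>) * (half_rate n a - half_rate n b))\<^sup>2 /
          (2 * (half_rate n a + half_rate n b)))) ^ card S \<le> exp (- q) ^ card S"
        using half_rate_signal_ge[OF \<gamma> \<epsilon> ab pos sig] by (intro power_mono) (auto simp: q_def)
      finally show "measure_pmf.prob ?M {A. S \<subseteq> misled n ?c e A} \<le> exp (- q) ^ s" using S by simp
    qed (use s in \<open>auto simp: misled_def\<close>)
    also have "\<dots> \<le> exp (- z) ^ s"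
    proof (rule power_mono)
      have "x * exp (- z) \<le> real s * exp (- z)" using s by (intro mult_right_mono) auto
      then show "exp 1 * real n * exp (- q) / real s \<le> exp (- z)"
        unfolding base using s by (simp add: divide_le_eq mult.commute)
    qed simp
    also have "\<dots> = exp (- (z * real s))" by (simp add: exp_of_nat_mult[symmetric] mult.commute)
    also have "\<dots> \<le> exp (- (z * x))" using s z by simp
    also have "z * x = 4 * real n * h" using z by (simp add: x_def)
    finally show ?thesis by simp
  qed
  have "measure_pmf.prob ?M {A. T \<le> worst_mismatch \<gamma> n a b chat A}
      \<le> measure_pmf.prob ?M (\<Union>e\<in>?E. {A. s \<le> card (misled n ?c e A)})"
  proof (rule measure_pmf.finite_measure_mono_AE)
    have "A \<in> (\<Union>e\<in>?E. {A. s \<le> card (misled n ?c e A)})"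
      if A: "A \<in> set_pmf ?M" "T \<le> worst_mismatch \<gamma> n a b chat A" for A
    proof -
      obtain e where e: "e \<in> ?E" "worst_mismatch \<gamma> n a b chat A \<le> real (card (misled n ?c e A)) / real n"
        using worst_mismatch_le[OF n \<gamma> ab pos, of chat A] ch[OF A(1)] by blast
      have "4 * h / z \<le> real (card (misled n ?c e A)) / real n"
        using e(2) A(2) T by (simp add: h_def)
      then have "x \<le> real (card (misled n ?c e A))"
        using n' by (simp add: x_def pos_le_divide_eq)
      then show ?thesis using e(1) by (auto simp: s_def ceiling_le_iff)
    qed
    then show "AE A in ?M. A \<in> {A. T \<le> worst_mismatch \<gamma> n a b chat A} \<longrightarrow>
        A \<in> (\<Union>e\<in>?E. {A. s \<le> card (misled n ?c e A)})"
      by (auto simp: AE_measure_pmf_iff)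
  qed auto
  also have "\<dots> \<le> (\<Sum>e\<in>?E. measure_pmf.prob ?M {A. s \<le> card (misled n ?c e A)})"
    by (rule measure_pmf.finite_measure_subadditive_finite[OF finite_initial_labelings]) auto
  also have "\<dots> \<le> (\<Sum>e\<in>?E. exp (- 4 * real n * h))" by (rule sum_mono) (rule tail)
  also have "\<dots> = real (card ?E) * exp (- 4 * real n * h)" by simp
  also have "\<dots> \<le> exp (real n * h) * exp (- 4 * real n * h)"
    using card_initial_labelings_le[OF \<gamma> n'(1)] by (intro mult_right_mono) (auto simp: h_def)
  also have "\<dots> = exp (- 3 * real n * h)" by (simp add: exp_add[symmetric])
  finally show ?thesis by (simp add: h_def)
qed

section \<open>The correction term \<open>kappa\<close>, the stated bound and consistency\<close>

text \<open>It suffices that \<open>3 * exp (n * kappa) \<ge> 1\<close>. From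
  \<open>4 * \<gamma> * (1 - \<gamma>) \<le> 1\<close> and \<open>pi < 4\<close> the argument of the
  logarithm in \<open>kappa\<close> is at least \<open>n / 4\<close>, hence at least
  \<open>1 / 3\<close>; the factor 3 absorbs a negative \<open>kappa\<close>.\<close>

lemma exp_three_entropy_le:
  assumes \<gamma>: "0 < \<gamma>" "\<gamma> < 1" and n: "2 \<le> n"
  shows "exp (- 3 * real n * binary_entropy \<gamma>) \<le> 3 * exp (- real n * (binary_entropy \<gamma> - kappa \<gamma> n))"
proof -
  let ?r = "real n / (4 * pi * \<gamma> * (1 - \<gamma>))"
  have g: "0 < \<gamma> * (1 - \<gamma>)" using \<gamma> by simp
  have "0 \<le> (\<gamma> - 1 / 2)\<^sup>2" by simp
  then have "4 * (\<gamma> * (1 - \<gamma>)) \<le> 1" by (simp add: power2_eq_square algebra_simps)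
  then have "4 * (\<gamma> * (1 - \<gamma>)) * pi \<le> 1 * 4" using pi_less_4 g by (intro mult_mono) auto
  then have "1 / 3 \<le> ?r" using n g \<gamma> by (simp add: field_simps)
  then have "1 \<le> 3 * exp (ln ?r)" using n \<gamma> by simp
  also have "\<dots> \<le> 3 * exp (real n * kappa \<gamma> n)" using n by (simp add: kappa_def)
  finally have "exp (- real n * binary_entropy \<gamma>) * 1
      \<le> exp (- real n * binary_entropy \<gamma>) * (3 * exp (real n * kappa \<gamma> n))"
    by (intro mult_left_mono) auto
  also have "\<dots> = 3 * exp (- real n * (binary_entropy \<gamma> - kappa \<gamma> n))"
    by (simp add: exp_add[symmetric] algebra_simps)
  finally have "exp (- real n * binary_entropy \<gamma>) \<le> 3 * exp (- real n * (binary_entropy \<gamma> - kappa \<gamma> n))"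
    by simp
  moreover have "exp (- 3 * real n * binary_entropy \<gamma>) \<le> exp (- real n * binary_entropy \<gamma>)"
    using binary_entropy_pos[OF \<gamma>] by simp
  ultimately show ?thesis by linarith
qed

lemma kappa_smallo:
  assumes "0 < \<gamma>" "\<gamma> < 1"
  shows "kappa \<gamma> \<in> o(\<lambda>_. 1)"
proof -
  define K where "K = 4 * pi * \<gamma> * (1 - \<gamma>)"
  have "0 < K" using assms by (simp add: K_def)
  then have "(\<lambda>n. 1 / real n * (ln (real n / K) + 1 / (3 * real n))) \<in> o(\<lambda>_. 1)"
    by real_asymp
  then show ?thesis unfolding kappa_def[abs_def] K_def .
qed

text \<open>The witnesses are \<open>u = exp x\<close> and \<open>v = exp y\<close>, where
  \<open>x\<close> and \<open>y\<close> are positive solutions of the two logarithmic conditions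
  with equality. Positivity gives \<open>u > 1\<close> and \<open>v > 1\<close>, so the iterated
  logarithms are genuine.\<close>

theorem theorem2:
  fixes \<gamma> \<epsilon> :: real and a b :: "nat \<Rightarrow> real"
    and chat :: "nat \<Rightarrow> adjacency \<Rightarrow> real \<Rightarrow> real \<Rightarrow> (nat \<Rightarrow> nat) \<Rightarrow> nat \<Rightarrow> nat"
  assumes "0 < \<gamma>" and "\<gamma> < 1" and "\<gamma> \<noteq> 1 / 2"
    and "0 < \<epsilon>" and "\<epsilon> < 1"
    and "\<And>n. n \<in> sizes \<gamma> \<Longrightarrow> a n \<in> {0..real (n div 2)}"
    and "\<And>n. n \<in> sizes \<gamma> \<Longrightarrow> b n \<in> {0..real (n div 2)}"
    and "\<And>n. n \<in> sizes \<gamma> \<Longrightarrow> a n \<noteq> b n"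
    and "\<And>n. n \<in> sizes \<gamma> \<Longrightarrow>
           2 * (1 + \<epsilon>) * mix \<gamma> (a n) (b n) \<le> \<epsilon> * (1 - 2 * \<gamma>) * (a n - b n)"
    and "\<And>n A ah bh e. n \<in> sizes \<gamma> \<Longrightarrow>
           A \<in> set_pmf (block_model n (true_label n) (edge_prob n (a n) (b n))) \<Longrightarrow>
           (ah, bh) \<in> param_estimates n (a n) (b n) \<Longrightarrow> e \<in> initial_labelings \<gamma> n \<Longrightarrow>
           chat n A ah bh e \<in> cpl_labelings n (true_label n) A ah bh e"
  shows "\<exists>u v :: nat \<Rightarrow> real.
    (\<forall>n \<in> sizes \<gamma>.
       u n > 1 \<and> v n > 1 \<and>
       ln (u n) + ln (ln (u n)) \<ge>
         ln (4 / exp 1 * binary_entropy \<gamma>)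
           + 1 / 4 * ((1 - \<epsilon>) * (1 - 2 * \<gamma>))\<^sup>2 * tau_sq (a n) (b n) \<and>
       ln (v n) + ln (ln (v n)) \<ge>
         ln (4 / exp 1 * binary_entropy \<gamma>) + \<epsilon>\<^sup>2 / (1 + \<epsilon> / 3) * mix \<gamma> (a n) (b n) \<and>
       measure_pmf.prob (block_model n (true_label n) (edge_prob n (a n) (b n)))
         {A. worst_mismatch \<gamma> n (a n) (b n) (chat n) A
               \<ge> 4 * binary_entropy \<gamma> * (1 / ln (u n) + 2 / ln (v n))}
         \<le> 3 * exp (- real n * (binary_entropy \<gamma> - kappa \<gamma> n))) \<and>
    kappa \<gamma> \<in> o(\<lambda>_. 1) \<and>
    (filterlim (\<lambda>n. tau_sq (a n) (b n)) at_top (size_filter \<gamma>) \<and>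
     filterlim (\<lambda>n. mix \<gamma> (a n) (b n)) at_top (size_filter \<gamma>) \<longrightarrow>
       filterlim u at_top (size_filter \<gamma>) \<and> filterlim v at_top (size_filter \<gamma>) \<and>
       (\<forall>\<delta>>0.
          ((\<lambda>n. measure_pmf.prob (block_model n (true_label n) (edge_prob n (a n) (b n)))
                  {A. worst_mismatch \<gamma> n (a n) (b n) (chat n) A > \<delta>}) \<longlongrightarrow> 0) (size_filter \<gamma>)))"
proof -
  note \<gamma> = assms(1,2) and \<epsilon> = assms(4,5)
  let ?h = "binary_entropy \<gamma>" and ?F = "size_filter \<gamma>"
  let ?pr = "\<lambda>n. measure_pmf.prob (block_model n (true_label n) (edge_prob n (a n) (b n)))"
  let ?W = "\<lambda>n. worst_mismatch \<gamma> n (a n) (b n) (chat n)"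
  define L where "L = ln (4 / exp 1 * ?h)"
  have h: "0 < ?h" by (rule binary_entropy_pos[OF \<gamma>])
  \<comment> \<open>As \<open>mix\<close> is nonnegative, the condition on \<open>\<epsilon>\<close>
    fixes the sign: \<open>a > b\<close> goes with \<open>\<gamma> < 1 / 2\<close> and
    \<open>a < b\<close> with \<open>\<gamma> > 1 / 2\<close>.\<close>
  have pos: "0 < (1 - 2 * \<gamma>) * (a n - b n)" if n: "n \<in> sizes \<gamma>" for n
  proof -
    have "0 \<le> 2 * (1 + \<epsilon>) * mix \<gamma> (a n) (b n)"
      using assms(6,7)[OF n] \<gamma> \<epsilon> by (auto simp: mix_def)
    also have "\<dots> \<le> \<epsilon> * ((1 - 2 * \<gamma>) * (a n - b n))" using assms(9)[OF n] by (simp add: mult.assoc)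
    finally have "0 \<le> (1 - 2 * \<gamma>) * (a n - b n)" using \<epsilon> by (simp add: zero_le_mult_iff)
    moreover have "(1 - 2 * \<gamma>) * (a n - b n) \<noteq> 0" using assms(3) assms(8)[OF n] by auto
    ultimately show ?thesis by linarith
  qed
  have "\<forall>n. \<exists>x>0. x + ln x = L + 1 / 4 * ((1 - \<epsilon>) * (1 - 2 * \<gamma>))\<^sup>2 * tau_sq (a n) (b n)"
    by (blast intro: ex_add_ln_eq)
  then obtain x where x: "\<And>n. 0 < x n"
      "\<And>n. x n + ln (x n) = L + 1 / 4 * ((1 - \<epsilon>) * (1 - 2 * \<gamma>))\<^sup>2 * tau_sq (a n) (b n)"
    by metis
  have "\<forall>n. \<exists>y>0. y + ln y = L + \<epsilon>\<^sup>2 / (1 + \<epsilon> / 3) * mix \<gamma> (a n) (b n)"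
    by (blast intro: ex_add_ln_eq)
  then obtain y where y: "\<And>n. 0 < y n" "\<And>n. y n + ln (y n) = L + \<epsilon>\<^sup>2 / (1 + \<epsilon> / 3) * mix \<gamma> (a n) (b n)"
    by metis
  have tail: "?pr n {A. T \<le> ?W n A} \<le> 3 * exp (- real n * (?h - kappa \<gamma> n))"
    if n: "n \<in> sizes \<gamma>" and T: "4 * ?h / x n \<le> T" for n T
  proof -
    have "?pr n {A. T \<le> ?W n A} \<le> exp (- 3 * real n * ?h)"
      using worst_mismatch_tail[OF n \<gamma> \<epsilon> assms(6)[OF n] assms(7)[OF n] pos[OF n] assms(9)[OF n]
          assms(10)[OF n] x(1)[of n] _ T] x(2)[of n] by (simp add: L_def)
    also have "\<dots> \<le> 3 * exp (- real n * (?h - kappa \<gamma> n))"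
      using n by (intro exp_three_entropy_le[OF \<gamma>]) (auto simp: sizes_def elim!: evenE)
    finally show ?thesis .
  qed
  have ev: "eventually (\<lambda>n. n \<in> sizes \<gamma>) ?F"
    by (simp add: size_filter_def eventually_inf_principal)
  show ?thesis
  proof (rule exI[of _ "\<lambda>n. exp (x n)"], rule exI[of _ "\<lambda>n. exp (y n)"], intro conjI ballI impI)
    fix n assume n: "n \<in> sizes \<gamma>"
    \<comment> \<open>Adding the positive \<open>2 / y n\<close> raises the threshold, so the tail
      bound at \<open>4 * h / x n\<close> applies.\<close>
    have "4 * ?h / x n \<le> 4 * ?h * (1 / x n + 2 / y n)"
      using h x(1)[of n] y(1)[of n] by (simp add: distrib_left)
    with tail[OF n this] show "?pr n {A. ?W n A \<ge> 4 * ?h * (1 / ln (exp (x n)) + 2 / ln (exp (y n)))}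
         \<le> 3 * exp (- real n * (?h - kappa \<gamma> n))" by simp
  next
    assume lim: "filterlim (\<lambda>n. tau_sq (a n) (b n)) at_top ?F \<and> filterlim (\<lambda>n. mix \<gamma> (a n) (b n)) at_top ?F"
    have "0 < 1 / 4 * ((1 - \<epsilon>) * (1 - 2 * \<gamma>))\<^sup>2" using assms(3) \<epsilon> by simp
    then have "filterlim (\<lambda>n. x n + ln (x n)) at_top ?F"
      unfolding x(2) using lim
      by (intro filterlim_tendsto_add_at_top[OF tendsto_const]
          filterlim_tendsto_pos_mult_at_top[OF tendsto_const]) auto
    then have xlim: "filterlim x at_top ?F"
      by (rule filterlim_add_ln_imp_at_top[OF always_eventually[OF allI[OF x(1)]]])
    have "0 < \<epsilon>\<^sup>2 / (1 + \<epsilon> / 3)" using \<epsilon> by simp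
    then have "filterlim (\<lambda>n. y n + ln (y n)) at_top ?F"
      unfolding y(2) using lim
      by (intro filterlim_tendsto_add_at_top[OF tendsto_const]
          filterlim_tendsto_pos_mult_at_top[OF tendsto_const]) auto
    then have ylim: "filterlim y at_top ?F"
      by (rule filterlim_add_ln_imp_at_top[OF always_eventually[OF allI[OF y(1)]]])
    show "filterlim (\<lambda>n. exp (x n)) at_top ?F" by (rule filterlim_compose[OF exp_at_top xlim])
    show "filterlim (\<lambda>n. exp (y n)) at_top ?F" by (rule filterlim_compose[OF exp_at_top ylim])
    show "\<forall>\<delta>>0. ((\<lambda>n. ?pr n {A. \<delta> < ?W n A}) \<longlongrightarrow> 0) ?F"
    proof (intro allI impI)
      fix \<delta> :: real assume \<delta>: "0 < \<delta>"
      have "((\<lambda>n. 3 * exp (- real n * (?h - kappa \<gamma> n))) \<longlongrightarrow> 0) sequentially"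
      proof -
        \<comment> \<open>The exponent is dominated by \<open>- n * H\<close>, because
          \<open>n * kappa\<close> grows only like \<open>ln n\<close>. Naming the constants lets
          \<open>real_asymp\<close> treat them as positive parameters.\<close>
        define H where "H = ?h"
        define K where "K = 4 * pi * \<gamma> * (1 - \<gamma>)"
        have "0 < K" "0 < H" using \<gamma> h by (simp_all add: K_def H_def)
        then have "((\<lambda>n. 3 * exp (- real n * (H - 1 / real n * (ln (real n / K) + 1 / (3 * real n)))))
            \<longlongrightarrow> 0) sequentially"
          by real_asymp
        then show ?thesis unfolding kappa_def K_def H_def .
      qed
      then have lim0: "((\<lambda>n. 3 * exp (- real n * (?h - kappa \<gamma> n))) \<longlongrightarrow> 0) ?F"
        by (rule tendsto_mono[rotated]) (simp add: size_filter_def)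
      \<comment> \<open>Once \<open>x n\<close> exceeds \<open>4 * h / \<delta>\<close>, the level
        \<open>\<delta>\<close> lies above the threshold of the tail bound.\<close>
      have "eventually (\<lambda>n. 4 * ?h / \<delta> \<le> x n) ?F" using xlim by (simp add: filterlim_at_top)
      then have "eventually (\<lambda>n. ?pr n {A. \<delta> < ?W n A} \<le> 3 * exp (- real n * (?h - kappa \<gamma> n))) ?F"
        using ev
      proof eventually_elim
        case (elim n)
        then have "4 * ?h / x n \<le> \<delta>" using \<delta> x(1)[of n] by (simp add: field_simps)
        have "?pr n {A. \<delta> < ?W n A} \<le> ?pr n {A. \<delta> \<le> ?W n A}"
          by (intro measure_pmf.finite_measure_mono) auto
        also note tail[OF elim(2) \<open>4 * ?h / x n \<le> \<delta>\<close>]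
        finally show ?case .
      qed
      then show "((\<lambda>n. ?pr n {A. \<delta> < ?W n A}) \<longlongrightarrow> 0) ?F"
        by (intro tendsto_sandwich[OF _ _ tendsto_const lim0]) auto
    qed
  qed (use x y L_def kappa_smallo[OF \<gamma>] in auto)
qed

end
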